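(* Let $\mu$ be a positive Borel measure on $[0,1)$ with $\int_{[0,1)}\log\frac{2}{1-t}\,d\mu(t)<\infty$. If the measure $\nu$ on $[0,1)$ defined by $d\nu(t)=\log\frac{2}{1-t}\,d\mu(t)$ is a Carleson measure, then $\mathcal H_\mu$ is well defined on the Bloch space $\mathcal B$ and $$\mathcal H_\mu(f)=I_\mu(f)\quad\text{for all } f\in\mathcal B.$$
   Context: $\mathbb D=\{z\in\mathbb C:|z|<1\}$. The Bloch space $\mathcal B$ is the set of analytic functions $f$ in $\mathbb D$ with $\|f\|_{\mathcal B}=|f(0)|+\sup_{z\in\mathbb D}(1-|z|^2)|f'(z)|<\infty$. For a finite positive Borel measure $\mu$ on $[0,1)$, $\mu_n=\int_{[0,1)}t^n\,d\mu(t)$ ($n=0,1,2,\dots$), and for $f(z)=\sum_{k\ge0}a_kz^k$ analytic in $\mathbb D$, $$\mathcal H_\mu(f)(z)=\sum_{n=0}^\infty\Big(\sum_{k=0}^\infty\mu_{n+k}a_k\Big)z^n,$$ whenever the right-hand side makes sense (all series converge) and defines an analytic function in $\mathbb D$; $\mathcal H_\mu$ is well defined on a space if this is the case for every $f$ in the space. Also $I_\mu(f)(z)=\int_{[0,1)}\frac{f(t)}{1-tz}\,d\mu(t)$, $z\in\mathbb D$ (under the integrability hypothesis on $\mu$ this is well defined and analytic for all $f\in\mathcal B$). A positive Borel measure $\nu$ on $[0,1)$ is a Carleson measure if there is $C>0$ with $\nu([t,1))\le C(1-t)$ for all $0\le t<1$. *)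

theory Defs
  imports "HOL-Complex_Analysis.Complex_Analysis"
begin

definition borel_measure_01 :: "real measure \<Rightarrow> bool" where
  "borel_measure_01 \<mu> \<longleftrightarrow> sets \<mu> = sets (restrict_space borel {0..<1})"

definition carleson :: "real measure \<Rightarrow> bool" where
  "carleson \<nu> \<longleftrightarrow> borel_measure_01 \<nu> \<and>
     (\<exists>C>0. \<forall>t\<in>{0..<1}. emeasure \<nu> {t..<1} \<le> ennreal (C * (1 - t)))"

text \<open>The norm takes values in the extended nonnegative reals, so that the supremum
  is infinite, not arbitrary, when the family is unbounded.\<close>

definition bloch_norm :: "(complex \<Rightarrow> complex) \<Rightarrow> ennreal" where
  "bloch_norm f = ennreal (norm (f 0)) +
     (SUP z\<in>ball 0 1. ennreal ((1 - (norm z)\<^sup>2) * norm (deriv f z)))"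

definition bloch :: "(complex \<Rightarrow> complex) set" where
  "bloch = {f. f analytic_on ball 0 1 \<and> bloch_norm f < \<infinity>}"

definition moment :: "real measure \<Rightarrow> nat \<Rightarrow> real" where
  "moment \<mu> n = (\<integral>t. t ^ n \<partial>\<mu>)"

definition hankel_term :: "real measure \<Rightarrow> (complex \<Rightarrow> complex) \<Rightarrow> nat \<Rightarrow> nat \<Rightarrow> complex" where
  "hankel_term \<mu> f n k = of_real (moment \<mu> (n + k)) * fps_nth (fps_expansion f 0) k"

definition hankel_coeff :: "real measure \<Rightarrow> (complex \<Rightarrow> complex) \<Rightarrow> nat \<Rightarrow> complex" where
  "hankel_coeff \<mu> f n = (\<Sum>k. hankel_term \<mu> f n k)"

definition hankel :: "real measure \<Rightarrow> (complex \<Rightarrow> complex) \<Rightarrow> complex \<Rightarrow> complex" where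
  "hankel \<mu> f z = (\<Sum>n. hankel_coeff \<mu> f n * z ^ n)"

text \<open>Integrals and infinite sums are total functions with arbitrary default values, so
  ``the right-hand side makes sense'' is spelled out: the moments exist and all series converge.\<close>

definition hankel_well_defined :: "real measure \<Rightarrow> (complex \<Rightarrow> complex) \<Rightarrow> bool" where
  "hankel_well_defined \<mu> f \<longleftrightarrow>
     (\<forall>n. integrable \<mu> (\<lambda>t. t ^ n)) \<and>
     (\<forall>n. summable (hankel_term \<mu> f n)) \<and>
     (\<forall>z\<in>ball 0 1. summable (\<lambda>n. hankel_coeff \<mu> f n * z ^ n)) \<and>
     hankel \<mu> f analytic_on ball 0 1"

definition hankel_well_defined_on :: "real measure \<Rightarrow> (complex \<Rightarrow> complex) set \<Rightarrow> bool" where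
  "hankel_well_defined_on \<mu> X \<longleftrightarrow> (\<forall>f\<in>X. hankel_well_defined \<mu> f)"

definition I_integrand :: "(complex \<Rightarrow> complex) \<Rightarrow> complex \<Rightarrow> real \<Rightarrow> complex" where
  "I_integrand f z t = f (of_real t) / (1 - of_real t * z)"

definition I_op :: "real measure \<Rightarrow> (complex \<Rightarrow> complex) \<Rightarrow> complex \<Rightarrow> complex" where
  "I_op \<mu> f z = (\<integral>t. I_integrand f z t \<partial>\<mu>)"

end

theory Submission
  imports Defs
begin

text \<open>
  Write \<open>a\<^sub>k\<close> for the Taylor coefficients of a Bloch function \<open>f\<close>. The theorem is an exchange of
  summation and integration, done twice: \<open>\<Sum>\<^sub>k \<mu>\<^sub>n\<^sub>+\<^sub>k a\<^sub>k\<close> should equal the integral of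
  \<open>t\<^sup>n f(t)\<close>, and summing these numbers against \<open>z\<^sup>n\<close> should produce the kernel \<open>1 / (1 - t z)\<close>.
  The second exchange only needs \<open>f\<close> to be \<open>\<mu>\<close>-integrable on \<open>[0,1)\<close>. The first needs more, namely
  that \<open>\<Sum>\<^sub>k |a\<^sub>k| t\<^sup>k\<close>, where all cancellation is lost, is still \<open>\<mu>\<close>-integrable. The logarithmic
  growth of Bloch functions does not control that series, and bounded coefficients alone would
  only give the majorant \<open>1 / (1 - t)\<close>, which a Carleson measure need not integrate.

  What saves the argument is the mean square size of the coefficients. On the circle
  \<open>|z|\<^sup>2 = t\<close> the derivative \<open>f'\<close>, with coefficients \<open>(k + 1) a\<^sub>k\<^sub>+\<^sub>1\<close>, is at most
  \<open>M / (1 - t)\<close>, so Parseval (\<open>coefficient_square_sum_le\<close>) bounds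
  \<open>\<Sum>\<^sub>k (k + 1)\<^sup>2 |a\<^sub>k\<^sub>+\<^sub>1|\<^sup>2 t\<^sup>k\<close> by \<open>M\<^sup>2 / (1 - t)\<^sup>2\<close>. The Cauchy-Schwarz inequality
  with weights \<open>t\<^sup>k\<close> then bounds \<open>\<Sum>\<^sub>k (k + 1) |a\<^sub>k\<^sub>+\<^sub>1| t\<^sup>k\<close> by \<open>M (1 - t) powr (-3/2)\<close>, and
  integrating in \<open>t\<close> yields \<open>\<Sum>\<^sub>k |a\<^sub>k| t\<^sup>k \<le> K / sqrt (1 - t)\<close> (\<open>bloch_majorant\<close>).

  Since \<open>log (2 / (1 - t)) \<ge> log 2\<close>, the measure \<open>\<mu>\<close> is itself a Carleson measure, and a dyadic
  decomposition of \<open>[0,1)\<close> shows that Carleson measures integrate \<open>1 / sqrt (1 - t)\<close>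
  (\<open>carleson_integrable_inverse_sqrt\<close>). Hence both exchanges are instances of dominated
  convergence (\<open>moment_pairing\<close>, \<open>geometric_kernel_sums\<close>).
\<close>

section \<open>Mean squares of power series coefficients\<close>

text \<open>Orthogonality of the characters of the cyclic group of order \<open>m\<close>. Averaging over roots of unity
  instead of integrating over the circle is enough for polynomials of degree below \<open>m\<close>.\<close>

lemma roots_of_unity_parseval:
  fixes c :: "nat \<Rightarrow> complex" and m :: nat
  defines "\<omega> \<equiv> \<lambda>j. cis (2 * pi * real j / real m)"
  assumes "m > 0"
  shows "(\<Sum>j<m. (norm (\<Sum>k<m. c k * \<omega> j ^ k))\<^sup>2) = real m * (\<Sum>k<m. (norm (c k))\<^sup>2)"
proof -
  have orth: "(\<Sum>j<m. \<omega> j ^ k * cnj (\<omega> j ^ l)) = (if k = l then of_nat m else 0)"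
    if "k < m" "l < m" for k l
  proof -
    define q where "q = \<omega> k / \<omega> l"
    have pw: "\<omega> j ^ k * cnj (\<omega> j ^ l) = q ^ j" for j
    proof -
      have "\<omega> j ^ k * cnj (\<omega> j ^ l)
          = cis (real k * (2 * pi * real j / real m) - real l * (2 * pi * real j / real m))"
        by (simp only: \<omega>_def Complex.DeMoivre cis_cnj cis_mult minus_mult_right
            diff_conv_add_uminus complex_cnj_power)
      also have "\<dots> = cis (real j * (2 * pi * real k / real m - 2 * pi * real l / real m))"
        by (simp add: algebra_simps)
      also have "\<dots> = q ^ j"
        unfolding q_def \<omega>_def Complex.DeMoivre cis_divide by simp
      finally show ?thesis .
    qed
    have qm: "q ^ m = 1"
    proof -
      have "\<omega> i ^ m = 1" for i
      proof -
        have "\<omega> i ^ m = cis (2 * pi * real i)"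
          using \<open>m > 0\<close> by (simp add: \<omega>_def Complex.DeMoivre)
        also have "\<dots> = 1" by (intro cis_multiple_2pi) auto
        finally show ?thesis .
      qed
      then show ?thesis by (simp add: q_def power_divide)
    qed
    show ?thesis
    proof (cases "k = l")
      case True
      then show ?thesis unfolding pw by (simp add: q_def \<omega>_def)
    next
      case False
      have "inj_on \<omega> {..<m}"
        using Complex.bij_betw_roots_unity[OF \<open>m > 0\<close>] unfolding \<omega>_def bij_betw_def by simp
      then have "\<omega> k \<noteq> \<omega> l" using that False by (auto dest: inj_onD)
      then have "q \<noteq> 1" by (auto simp: q_def)
      then have "(\<Sum>j<m. q ^ j) = 0" using qm by (simp add: geometric_sum)
      then show ?thesis unfolding pw using False by simp
    qed
  qed
  have "complex_of_real (\<Sum>j<m. (norm (\<Sum>k<m. c k * \<omega> j ^ k))\<^sup>2)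
      = (\<Sum>j<m. \<Sum>k<m. \<Sum>l<m. c k * cnj (c l) * (\<omega> j ^ k * cnj (\<omega> j ^ l)))"
    unfolding of_real_sum complex_norm_square cnj_sum sum_product
    by (intro sum.cong refl) (simp add: mult_ac)
  also have "\<dots> = (\<Sum>k<m. \<Sum>l<m. \<Sum>j<m. c k * cnj (c l) * (\<omega> j ^ k * cnj (\<omega> j ^ l)))"
    by (subst sum.swap, intro sum.cong refl sum.swap)
  also have "\<dots> = (\<Sum>k<m. \<Sum>l<m. c k * cnj (c l) * (if k = l then of_nat m else 0))"
    by (intro sum.cong refl) (simp add: sum_distrib_left [symmetric] orth del: complex_cnj_power)
  also have "\<dots> = (\<Sum>k<m. \<Sum>l<m. if k = l then c k * cnj (c k) * of_nat m else 0)"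
    by (intro sum.cong refl) auto
  also have "\<dots> = (\<Sum>k<m. c k * cnj (c k) * of_nat m)"
    by (intro sum.cong refl) (simp add: sum.delta)
  also have "\<dots> = complex_of_real (real m * (\<Sum>k<m. (norm (c k))\<^sup>2))"
    unfolding of_real_mult of_real_sum complex_norm_square sum_distrib_left
    by (simp add: mult_ac)
  finally show ?thesis by (simp only: of_real_eq_iff)
qed

text \<open>The partial sum with \<open>m\<close> terms is a polynomial of degree below \<open>m\<close>, so the discrete Parseval
  identity applies to it exactly. By absolute convergence on the circle it exceeds the bound \<open>B\<close> of
  the full series by at most the tail \<open>e m\<close>, which vanishes as \<open>m\<close> grows.\<close>

lemma coefficient_square_sum_le:
  fixes b :: "nat \<Rightarrow> complex"
  assumes "0 \<le> r" and abs: "summable (\<lambda>k. norm (b k) * r ^ k)"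
    and bound: "\<And>z. norm z = r \<Longrightarrow> norm (\<Sum>k. b k * z ^ k) \<le> B"
  shows "(\<Sum>k<N. (norm (b k))\<^sup>2 * r ^ (2 * k)) \<le> B\<^sup>2"
proof -
  define e where "e m = (\<Sum>k. norm (b k) * r ^ k) - (\<Sum>k<m. norm (b k) * r ^ k)" for m
  have e0: "e \<longlonglongrightarrow> 0"
    using tendsto_diff[OF tendsto_const[of "\<Sum>k. norm (b k) * r ^ k"] summable_LIMSEQ[OF abs]]
    by (simp add: e_def [abs_def])
  have partial: "norm (\<Sum>k<m. b k * z ^ k) \<le> B + e m" if z: "norm z = r" for z m
  proof -
    have sn: "summable (\<lambda>k. norm (b k * z ^ k))"
      using abs by (simp add: norm_mult norm_power z)
    have "(\<Sum>k<m. b k * z ^ k) = (\<Sum>k. b k * z ^ k) - (\<Sum>k. b (k + m) * z ^ (k + m))"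
      using suminf_split_initial_segment[OF summable_norm_cancel[OF sn], of m] by simp
    then have "norm (\<Sum>k<m. b k * z ^ k)
        \<le> norm (\<Sum>k. b k * z ^ k) + norm (\<Sum>k. b (k + m) * z ^ (k + m))"
      by (simp add: norm_triangle_ineq4)
    also have "norm (\<Sum>k. b (k + m) * z ^ (k + m)) \<le> (\<Sum>k. norm (b (k + m) * z ^ (k + m)))"
      using sn by (intro summable_norm) (simp add: summable_iff_shift[of "\<lambda>k. norm (b k * z ^ k)"])
    also have "\<dots> = e m"
      using suminf_split_initial_segment[OF abs, of m]
      by (simp add: e_def norm_mult norm_power z)
    finally show ?thesis using bound[OF z] by simp
  qed
  have fin: "(\<Sum>k<N. (norm (b k))\<^sup>2 * r ^ (2 * k)) \<le> (B + e m)\<^sup>2" if "m \<ge> Suc N" for m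
  proof -
    define \<omega> where "\<omega> j = cis (2 * pi * real j / real m)" for j
    have "(\<Sum>k<N. (norm (b k))\<^sup>2 * r ^ (2 * k)) \<le> (\<Sum>k<m. (norm (b k))\<^sup>2 * r ^ (2 * k))"
      using that \<open>0 \<le> r\<close> by (intro sum_mono2) auto
    also have "\<dots> = (\<Sum>k<m. (norm (b k * of_real r ^ k))\<^sup>2)"
      using \<open>0 \<le> r\<close> by (simp add: norm_mult norm_power power_mult_distrib power_mult mult.commute[of 2])
    finally have "real m * (\<Sum>k<N. (norm (b k))\<^sup>2 * r ^ (2 * k))
        \<le> real m * (\<Sum>k<m. (norm (b k * of_real r ^ k))\<^sup>2)"
      by (intro mult_left_mono) auto
    also have "\<dots> = (\<Sum>j<m. (norm (\<Sum>k<m. b k * of_real r ^ k * \<omega> j ^ k))\<^sup>2)"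
      using that unfolding \<omega>_def by (intro roots_of_unity_parseval[symmetric]) auto
    also have "\<dots> = (\<Sum>j<m. (norm (\<Sum>k<m. b k * (of_real r * \<omega> j) ^ k))\<^sup>2)"
      by (simp add: power_mult_distrib mult.assoc)
    also have "\<dots> \<le> (\<Sum>j<m. (B + e m)\<^sup>2)"
      using \<open>0 \<le> r\<close> by (intro sum_mono power_mono partial) (auto simp: norm_mult \<omega>_def)
    finally show ?thesis using that by simp
  qed
  have "(\<lambda>m. (B + e m)\<^sup>2) \<longlonglongrightarrow> (B + 0)\<^sup>2" by (intro tendsto_intros e0)
  then show ?thesis using fin by (intro LIMSEQ_le_const[where X = "\<lambda>m. (B + e m)\<^sup>2"]) auto
qed

section \<open>Coefficients of Bloch functions\<close>

lemma bloch_deriv_bound: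
  assumes "f \<in> bloch"
  obtains M where "M \<ge> 0" "\<And>z. norm z < 1 \<Longrightarrow> norm (deriv f z) \<le> M / (1 - (norm z)\<^sup>2)"
proof -
  define S where "S = (SUP z\<in>ball 0 1. ennreal ((1 - (norm z)\<^sup>2) * norm (deriv f z)))"
  have "S < \<infinity>" using assms by (auto simp: bloch_def bloch_norm_def S_def)
  then have S: "S = ennreal (enn2real S)" by (simp add: less_top)
  have "norm (deriv f z) \<le> enn2real S / (1 - (norm z)\<^sup>2)" if "norm z < 1" for z
  proof -
    have "(norm z)\<^sup>2 < 1" using that by (simp add: power_less_one_iff abs_square_less_1)
    moreover have "ennreal ((1 - (norm z)\<^sup>2) * norm (deriv f z)) \<le> ennreal (enn2real S)"
      unfolding S[symmetric] by (subst S_def, rule SUP_upper) (use that in auto)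
    then have "(1 - (norm z)\<^sup>2) * norm (deriv f z) \<le> enn2real S"
      by (simp add: ennreal_le_iff)
    ultimately show ?thesis by (simp add: pos_le_divide_eq mult.commute)
  qed
  then show ?thesis using that[of "enn2real S"] by simp
qed

lemma bloch_expansion_sums:
  assumes "f \<in> bloch" "norm z < 1"
  shows "(\<lambda>k. fps_nth (fps_expansion f 0) k * z ^ k) sums f z"
proof -
  have "f holomorphic_on ball 0 1"
    using assms by (simp add: bloch_def analytic_imp_holomorphic)
  from holomorphic_power_series[OF this, of z] assms show ?thesis
    by (simp add: fps_expansion_def)
qed

lemma bloch_deriv_expansion_sums:
  assumes "f \<in> bloch" "norm z < 1"
  shows "(\<lambda>k. of_nat (Suc k) * fps_nth (fps_expansion f 0) (Suc k) * z ^ k) sums deriv f z"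
proof -
  have "f holomorphic_on ball 0 1"
    using assms by (simp add: bloch_def analytic_imp_holomorphic)
  then have "deriv f holomorphic_on ball 0 1" by (intro holomorphic_deriv) auto
  from holomorphic_power_series[OF this, of z] assms show ?thesis
    by (simp add: fps_expansion_def funpow_swap1 field_simps del: of_nat_Suc)
qed


text \<open>The gain over the trivial majorant \<open>1 / (1 - t)\<close> comes from \<open>l2\<close>, which is Parseval for the
  derivative. All estimates are for partial sums, so no convergence of \<open>\<Sum>\<^sub>k |a\<^sub>k| t\<^sup>k\<close> has to be
  known beforehand and the integration in \<open>t\<close> is a monotonicity argument for polynomials.\<close>

lemma bloch_majorant:
  assumes "f \<in> bloch"
  obtains K where
    "\<And>N t. 0 \<le> t \<Longrightarrow> t < 1 \<Longrightarrow>
       (\<Sum>k<N. norm (fps_nth (fps_expansion f 0) k) * t ^ k) \<le> K / sqrt (1 - t)"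
proof -
  define a where "a k = fps_nth (fps_expansion f 0) k" for k
  define b where "b k = of_nat (Suc k) * a (Suc k)" for k
  obtain M where M: "M \<ge> 0" "\<And>z. norm z < 1 \<Longrightarrow> norm (deriv f z) \<le> M / (1 - (norm z)\<^sup>2)"
    using bloch_deriv_bound[OF assms] by blast
  have bsums: "(\<lambda>k. b k * z ^ k) sums deriv f z" if "norm z < 1" for z
    using bloch_deriv_expansion_sums[OF assms that] by (simp add: b_def a_def)
  have l2: "(\<Sum>k<N. (norm (b k))\<^sup>2 * t ^ k) \<le> (M / (1 - t))\<^sup>2" if t: "0 \<le> t" "t < 1" for t N
  proof -
    have r: "0 \<le> sqrt t" "sqrt t < 1" using t by auto
    obtain x where x: "sqrt t < x" "x < 1" using dense r(2) by blast
    have "summable (\<lambda>k. b k * of_real x ^ k)"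
      using bsums[of "of_real x"] x r by (auto dest: sums_summable)
    then have "summable (\<lambda>k. norm (b k * of_real (sqrt t) ^ k))"
      using x r by (intro powser_insidea[of b "of_real x"]) auto
    then have "summable (\<lambda>k. norm (b k) * sqrt t ^ k)"
      using r by (simp add: norm_mult norm_power)
    moreover have "norm (\<Sum>k. b k * z ^ k) \<le> M / (1 - t)" if "norm z = sqrt t" for z
      using M(2)[of z] sums_unique[OF bsums, of z] that r t by simp
    ultimately have "(\<Sum>k<N. (norm (b k))\<^sup>2 * sqrt t ^ (2 * k)) \<le> (M / (1 - t))\<^sup>2"
      by (intro coefficient_square_sum_le r(1))
    then show ?thesis using t by (simp add: power_mult)
  qed
  have l1: "(\<Sum>k<N. norm (b k) * t ^ k) \<le> M / ((1 - t) * sqrt (1 - t))"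
    if t: "0 \<le> t" "t < 1" for t N
  proof (rule power2_le_imp_le)
    have "(\<Sum>k<N. norm (b k) * t ^ k) = (\<Sum>k<N. (norm (b k) * sqrt t ^ k) * sqrt t ^ k)"
      using t by (simp add: mult.assoc flip: power_mult_distrib)
    then have "(\<Sum>k<N. norm (b k) * t ^ k)\<^sup>2
        \<le> (\<Sum>k<N. (norm (b k) * sqrt t ^ k)\<^sup>2) * (\<Sum>k<N. (sqrt t ^ k)\<^sup>2)"
      using Cauchy_Schwarz_ineq_sum[of "\<lambda>k. norm (b k) * sqrt t ^ k" "\<lambda>k. sqrt t ^ k" "{..<N}"]
      by simp
    also have "\<dots> = (\<Sum>k<N. (norm (b k))\<^sup>2 * t ^ k) * (\<Sum>k<N. t ^ k)"
      using t by (simp add: power_mult_distrib power_even_eq[symmetric] power_mult)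
    also have "\<dots> \<le> (M / (1 - t))\<^sup>2 * (1 / (1 - t))"
    proof (intro mult_mono l2 t)
      have "(\<Sum>k<N. t ^ k) \<le> (\<Sum>k. t ^ k)"
        using t by (intro sum_le_suminf summable_geometric) auto
      then show "(\<Sum>k<N. t ^ k) \<le> 1 / (1 - t)" using t by (simp add: suminf_geometric)
    qed (use t in \<open>auto intro: sum_nonneg\<close>)
    also have "\<dots> = (M / ((1 - t) * sqrt (1 - t)))\<^sup>2"
      using t by (simp add: power_divide power_mult_distrib)
    finally show "(\<Sum>k<N. norm (b k) * t ^ k)\<^sup>2 \<le> (M / ((1 - t) * sqrt (1 - t)))\<^sup>2" .
  qed (use M t in auto)
  have "(\<Sum>k<N. norm (a k) * t ^ k) \<le> (norm (a 0) + 2 * M) / sqrt (1 - t)"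
    if t: "0 \<le> t" "t < 1" for t N
  proof -
    \<comment> \<open>\<open>2 * M / sqrt (1 - x)\<close> is an antiderivative of the bound in \<open>l1\<close>, so \<open>h\<close> decreases.\<close>
    define h where
      "h x = norm (a 0) + (\<Sum>k<N. norm (a (Suc k)) * x ^ Suc k) - 2 * M / sqrt (1 - x)" for x
    have "h t \<le> h 0"
    proof (rule DERIV_nonpos_imp_nonincreasing[OF t(1)])
      fix x assume x: "0 \<le> x" "x \<le> t"
      have "(h has_real_derivative
          (\<Sum>k<N. norm (b k) * x ^ k) - M / ((1 - x) * sqrt (1 - x))) (at x)"
        unfolding h_def
      proof (intro DERIV_diff)
        show "((\<lambda>x. norm (a 0) + (\<Sum>k<N. norm (a (Suc k)) * x ^ Suc k)) has_real_derivative
            (\<Sum>k<N. norm (b k) * x ^ k)) (at x)"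
          by (auto intro!: derivative_eq_intros sum.cong simp: b_def norm_mult simp del: of_nat_Suc power_Suc)
        show "((\<lambda>x. 2 * M / sqrt (1 - x)) has_real_derivative M / ((1 - x) * sqrt (1 - x))) (at x)"
          using x t by (auto intro!: derivative_eq_intros simp: field_simps)
      qed
      moreover have "(\<Sum>k<N. norm (b k) * x ^ k) - M / ((1 - x) * sqrt (1 - x)) \<le> 0"
        using l1[of x N] x t by simp
      ultimately show "\<exists>y. (h has_real_derivative y) (at x) \<and> y \<le> 0" by blast
    qed
    moreover have "(\<Sum>k<N. norm (a k) * t ^ k) \<le> (\<Sum>k<Suc N. norm (a k) * t ^ k)"
      using t by (intro sum_mono2) auto
    ultimately have "(\<Sum>k<N. norm (a k) * t ^ k) \<le> norm (a 0) + 2 * M / sqrt (1 - t)"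
      using M(1) by (simp add: h_def sum.lessThan_Suc_shift del: sum.lessThan_Suc)
    also have "norm (a 0) \<le> norm (a 0) / sqrt (1 - t)"
      using t by (simp add: pos_le_divide_eq mult_left_le)
    finally show ?thesis by (simp add: add_divide_distrib)
  qed
  then show ?thesis using that[of "norm (a 0) + 2 * M"] unfolding a_def by simp
qed

section \<open>Carleson measures\<close>

lemma borel_measure_01_measurable:
  fixes g :: "real \<Rightarrow> 'b::topological_space"
  assumes "borel_measure_01 \<mu>" "continuous_on {0..<1} g"
  shows "g \<in> borel_measurable \<mu>"
  using borel_measurable_continuous_on_restrict[OF assms(2)] assms(1)
  by (metis borel_measure_01_def measurable_cong_sets)

lemma borel_measure_01_space:
  assumes "borel_measure_01 \<mu>"
  shows "space \<mu> = {0..<1}"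
  using assms sets_eq_imp_space_eq[of \<mu> "restrict_space borel {0..<1}"]
  by (simp add: borel_measure_01_def space_restrict_space)

lemma borel_measure_01_atLeastLessThan:
  assumes "borel_measure_01 \<mu>" "0 \<le> t"
  shows "{t..<1} \<in> sets \<mu>"
  using assms by (auto simp: borel_measure_01_def sets_restrict_space_iff)

text \<open>On the dyadic piece where \<open>1 - t\<close> is comparable to \<open>4\<^sup>-\<^sup>j\<close> the integrand is comparable to
  \<open>2\<^sup>j\<close>, while the measure of that piece is of order at most \<open>4\<^sup>-\<^sup>j\<close>; the products are summable.\<close>

lemma carleson_integrable_inverse_sqrt:
  assumes "carleson \<mu>"
  shows "integrable \<mu> (\<lambda>t. 1 / sqrt (1 - t))"
proof (rule integrableI_nonneg)
  have \<mu>: "borel_measure_01 \<mu>" using assms by (simp add: carleson_def)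
  obtain C where C: "C > 0" "\<And>t. t \<in> {0..<1} \<Longrightarrow> emeasure \<mu> {t..<1} \<le> ennreal (C * (1 - t))"
    using assms by (auto simp: carleson_def)
  define A where "A j = {1 - 1 / 4 ^ j..<1::real}" for j :: nat
  have A [measurable]: "A j \<in> sets \<mu>" for j
    unfolding A_def by (intro borel_measure_01_atLeastLessThan \<mu>) simp
  show "(\<lambda>t. 1 / sqrt (1 - t)) \<in> borel_measurable \<mu>"
    by (intro borel_measure_01_measurable \<mu> continuous_intros) auto
  show "AE t in \<mu>. 0 \<le> 1 / sqrt (1 - t)"
    by (intro AE_I2) (auto simp: borel_measure_01_space[OF \<mu>])
  \<comment> \<open>The sets \<open>A j\<close> are nested rather than disjoint; one suitable \<open>j\<close> already dominates the integrand.\<close>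
  have dom: "ennreal (1 / sqrt (1 - t)) \<le> (\<Sum>j. ennreal (2 ^ Suc j) * indicator (A j) t)"
    if t: "t \<in> space \<mu>" for t
  proof -
    have t: "0 \<le> t" "t < 1" using t by (auto simp: borel_measure_01_space[OF \<mu>])
    define P where "P j \<longleftrightarrow> (1 / 4 :: real) ^ Suc j < 1 - t" for j
    have "\<exists>j. P j"
    proof -
      obtain n where n: "(1 / 4 :: real) ^ n < 1 - t"
        using real_arch_pow_inv[of "1 - t" "1 / 4"] t by auto
      have "(1 / 4 :: real) ^ Suc n \<le> (1 / 4) ^ n" by (intro power_decreasing) auto
      with n show ?thesis unfolding P_def by (intro exI[of _ n]) linarith
    qed
    define j where "j = (LEAST j. P j)"
    have "P j" unfolding j_def using \<open>\<exists>j. P j\<close> by (rule LeastI_ex)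
    have "1 - t \<le> (1 / 4) ^ j"
    proof (cases j)
      case (Suc i)
      then have "\<not> P i" using not_less_Least[of i P] by (simp add: j_def)
      then show ?thesis by (simp add: P_def Suc)
    qed (use t in simp)
    then have "t \<in> A j" using t by (simp add: A_def power_one_over)
    have "(1 / 2 :: real) ^ Suc j \<le> sqrt (1 - t)"
    proof (rule real_le_rsqrt)
      have "((1 / 2 :: real) ^ Suc j)\<^sup>2 = ((1 / 2)\<^sup>2) ^ Suc j"
        by (simp only: power_mult[symmetric] mult.commute)
      also have "\<dots> = (1 / 4) ^ Suc j" by (simp add: power2_eq_square)
      finally show "((1 / 2 :: real) ^ Suc j)\<^sup>2 \<le> 1 - t" using \<open>P j\<close> by (simp add: P_def)
    qed
    then have "1 / sqrt (1 - t) \<le> 1 / (1 / 2) ^ Suc j"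
      by (intro divide_left_mono) (use t in auto)
    also have "\<dots> = 2 ^ Suc j" by (simp add: power_one_over)
    finally have "ennreal (1 / sqrt (1 - t)) \<le> ennreal (2 ^ Suc j) * indicator (A j) t"
      using \<open>t \<in> A j\<close> by (simp add: ennreal_leI)
    also have "\<dots> \<le> (\<Sum>j. ennreal (2 ^ Suc j) * indicator (A j) t)"
      using sum_le_suminf[of "\<lambda>j. ennreal (2 ^ Suc j) * indicator (A j) t" "{j}"]
      by (simp only: summableI finite.emptyI finite_insert sum.insert sum.empty empty_iff add_0_right
          not_False_eq_True zero_le simp_thms)
    finally show ?thesis .
  qed
  have "(\<integral>\<^sup>+ t. ennreal (1 / sqrt (1 - t)) \<partial>\<mu>)
      \<le> (\<integral>\<^sup>+ t. (\<Sum>j. ennreal (2 ^ Suc j) * indicator (A j) t) \<partial>\<mu>)"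
    by (intro nn_integral_mono dom)
  also have "\<dots> = (\<Sum>j. \<integral>\<^sup>+ t. ennreal (2 ^ Suc j) * indicator (A j) t \<partial>\<mu>)"
    by (intro nn_integral_suminf) measurable
  also have "\<dots> = (\<Sum>j. ennreal (2 ^ Suc j) * emeasure \<mu> (A j))"
    by (simp add: nn_integral_cmult_indicator)
  also have "\<dots> \<le> (\<Sum>j. ennreal (2 * C * (1 / 2) ^ j))"
  proof (intro suminf_le summableI)
    fix j :: nat
    have "ennreal (2 ^ Suc j) * emeasure \<mu> (A j) \<le> ennreal (2 ^ Suc j) * ennreal (C * (1 / 4 ^ j))"
      using C(2)[of "1 - 1 / 4 ^ j"] unfolding A_def by (intro mult_left_mono) auto
    also have "\<dots> = ennreal (2 ^ Suc j * (C * (1 / 4 ^ j)))"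
      using C(1) by (intro ennreal_mult[symmetric]) auto
    also have "2 ^ Suc j * (C * (1 / 4 ^ j)) = 2 * C * (1 / 2) ^ j"
    proof -
      have "(4::real) ^ j = 2 ^ j * 2 ^ j" by (simp flip: power_mult_distrib)
      then show ?thesis by (simp add: power_one_over field_simps)
    qed
    finally show "ennreal (2 ^ Suc j) * emeasure \<mu> (A j) \<le> ennreal (2 * C * (1 / 2) ^ j)" .
  qed
  also have "\<dots> = ennreal (\<Sum>j. 2 * C * (1 / 2) ^ j)"
    using C(1) by (intro suminf_ennreal2 summable_mult summable_geometric) auto
  also have "\<dots> < \<infinity>" by simp
  finally show "(\<integral>\<^sup>+ t. ennreal (1 / sqrt (1 - t)) \<partial>\<mu>) < \<infinity>" .
qed

lemma carleson_of_log_carleson: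
  assumes \<mu>: "borel_measure_01 \<mu>"
    and "carleson (density \<mu> (\<lambda>t. ennreal (ln (2 / (1 - t)))))"
  shows "carleson \<mu>"
proof -
  obtain C where C: "C > 0" "\<And>t. t \<in> {0..<1} \<Longrightarrow>
      emeasure (density \<mu> (\<lambda>t. ennreal (ln (2 / (1 - t))))) {t..<1} \<le> ennreal (C * (1 - t))"
    using assms(2) by (auto simp: carleson_def)
  have [measurable]: "(\<lambda>t. ln (2 / (1 - t))) \<in> borel_measurable \<mu>"
    by (intro borel_measure_01_measurable[OF \<mu>] continuous_intros) auto
  have "emeasure \<mu> {t..<1} \<le> ennreal (C / ln 2 * (1 - t))" if t: "t \<in> {0..<1}" for t
  proof -
    have S [measurable]: "{t..<1} \<in> sets \<mu>"
      using t by (intro borel_measure_01_atLeastLessThan \<mu>) auto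
    have "ennreal (ln 2) * emeasure \<mu> {t..<1} = (\<integral>\<^sup>+ s. ennreal (ln 2) * indicator {t..<1} s \<partial>\<mu>)"
      by (simp add: nn_integral_cmult_indicator)
    also have "\<dots> \<le> (\<integral>\<^sup>+ s. ennreal (ln (2 / (1 - s))) * indicator {t..<1} s \<partial>\<mu>)"
    proof (intro nn_integral_mono)
      fix s
      show "ennreal (ln 2) * indicator {t..<1} s \<le> ennreal (ln (2 / (1 - s))) * indicator {t..<1} s"
      proof (cases "s \<in> {t..<1}")
        case True
        then have "2 \<le> 2 / (1 - s)" using t by (auto simp: pos_le_divide_eq)
        then have "ln 2 \<le> ln (2 / (1 - s))" by (intro ln_mono) auto
        then show ?thesis using True by (simp add: ennreal_leI)
      qed simp
    qed
    also have "\<dots> = emeasure (density \<mu> (\<lambda>t. ennreal (ln (2 / (1 - t))))) {t..<1}"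
      by (intro emeasure_density[symmetric]) measurable
    also have "\<dots> \<le> ennreal (C * (1 - t))" by (rule C(2)[OF t])
    finally have "ennreal (1 / ln 2) * (ennreal (ln 2) * emeasure \<mu> {t..<1})
        \<le> ennreal (1 / ln 2) * ennreal (C * (1 - t))"
      by (intro mult_left_mono) auto
    moreover have "ennreal (1 / ln 2) * ennreal (ln 2) = 1"
      by (simp flip: ennreal_mult)
    moreover have "ennreal (1 / ln 2) * ennreal (C * (1 - t)) = ennreal (C / ln 2 * (1 - t))"
      using t C(1) by (simp flip: ennreal_mult)
    ultimately show ?thesis by (simp add: mult.assoc[symmetric])
  qed
  moreover have "C / ln 2 > 0" using C(1) by simp
  ultimately show ?thesis using \<mu> unfolding carleson_def by blast
qed

section \<open>Exchanging sums and integrals\<close>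

text \<open>The majorant is imposed on the absolute values of the terms, since the series of moments is
  exchanged with the integral term by term. As \<open>t\<^sup>n \<le> 1\<close>, one majorant serves every \<open>n\<close>.\<close>

lemma moment_pairing:
  fixes a :: "nat \<Rightarrow> complex"
  assumes sp: "space \<mu> = {0..<1}"
    and w: "integrable \<mu> w"
    and mom: "\<And>k. integrable \<mu> (\<lambda>t. t ^ k)"
    and dom: "\<And>N t. t \<in> {0..<1} \<Longrightarrow> (\<Sum>k<N. norm (a k) * t ^ k) \<le> w t"
  shows "integrable \<mu> (\<lambda>t. of_real (t ^ n) * (\<Sum>k. a k * of_real t ^ k))" (is ?A)
    and "(\<lambda>k. of_real (moment \<mu> (n + k)) * a k) sums
           (\<integral>t. of_real (t ^ n) * (\<Sum>k. a k * of_real t ^ k) \<partial>\<mu>)" (is ?B)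
proof -
  define g where "g k t = of_real (t ^ (n + k)) * a k" for k t
  have int: "integrable \<mu> (g k)" for k
    unfolding g_def by (intro integrable_mult_left integrable_of_real mom)
  have norm_g: "norm (g k t) \<le> norm (a k) * t ^ k" if "t \<in> {0..<1}" for k t
  proof -
    have "t ^ (n + k) \<le> t ^ k" using that by (intro power_decreasing) auto
    then show ?thesis using that
      by (simp add: g_def norm_mult norm_power mult.commute[of _ "norm (a k)"] mult_left_mono)
  qed
  have sums_g: "(\<Sum>k<N. norm (g k t)) \<le> w t" if "t \<in> {0..<1}" for N t
    using sum_mono[of "{..<N}" "\<lambda>k. norm (g k t)" "\<lambda>k. norm (a k) * t ^ k"] norm_g[OF that]
      dom[OF that, of N] by force
  have AE: "AE t in \<mu>. summable (\<lambda>k. norm (g k t))"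
  proof (intro AE_I2)
    fix t assume "t \<in> space \<mu>"
    then show "summable (\<lambda>k. norm (g k t))"
      using sums_g[of t] by (intro bounded_imp_summable[where B = "w t"])
        (auto simp: sp simp flip: lessThan_Suc_atMost simp del: sum.lessThan_Suc)
  qed
  have sm: "summable (\<lambda>k. \<integral>t. norm (g k t) \<partial>\<mu>)"
  proof (rule bounded_imp_summable)
    fix N
    have "(\<Sum>k\<le>N. \<integral>t. norm (g k t) \<partial>\<mu>) = (\<integral>t. (\<Sum>k<Suc N. norm (g k t)) \<partial>\<mu>)"
      using int by (simp add: lessThan_Suc_atMost del: sum.lessThan_Suc)
    also have "\<dots> \<le> (\<integral>t. w t \<partial>\<mu>)"
      using int by (intro integral_mono w sums_g Bochner_Integration.integrable_sum integrable_norm)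
        (auto simp: sp)
    finally show "(\<Sum>k\<le>N. \<integral>t. norm (g k t) \<partial>\<mu>) \<le> (\<integral>t. w t \<partial>\<mu>)" .
  qed simp
  have eq: "(\<Sum>k. g k t) = of_real (t ^ n) * (\<Sum>k. a k * of_real t ^ k)" if "t \<in> {0..<1}" for t
  proof -
    have "summable (\<lambda>k. norm (a k * of_real t ^ k))"
      by (rule bounded_imp_summable[where B = "w t"])
        (use dom[OF that] that in \<open>auto simp: norm_mult norm_power
           simp flip: lessThan_Suc_atMost simp del: sum.lessThan_Suc\<close>)
    then have "summable (\<lambda>k. a k * of_real t ^ k)" by (rule summable_norm_cancel)
    from suminf_mult[OF this, of "of_real (t ^ n)"] show ?thesis
      by (simp add: g_def power_add mult_ac)
  qed
  have "integrable \<mu> (\<lambda>t. \<Sum>k. g k t)" by (rule integrable_suminf[OF int AE sm])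
  then show ?A using eq sp
    by (subst Bochner_Integration.integrable_cong[OF refl, of _ _ "\<lambda>t. \<Sum>k. g k t"]) auto
  have "(\<lambda>k. \<integral>t. g k t \<partial>\<mu>) sums (\<integral>t. (\<Sum>k. g k t) \<partial>\<mu>)"
    by (rule sums_integral[OF int AE sm])
  moreover have "(\<integral>t. g k t \<partial>\<mu>) = of_real (moment \<mu> (n + k)) * a k" for k
    unfolding g_def moment_def by (simp add: integral_complex_of_real del: of_real_power)
  moreover have "(\<integral>t. (\<Sum>k. g k t) \<partial>\<mu>) = (\<integral>t. of_real (t ^ n) * (\<Sum>k. a k * of_real t ^ k) \<partial>\<mu>)"
    using eq sp by (intro Bochner_Integration.integral_cong) auto
  ultimately show ?B by simp
qed

text \<open>Here \<open>|t z| \<le> |z| < 1\<close>, so expanding the kernel in powers of \<open>t z\<close> is dominated by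
  \<open>|F(t)|\<close> times a geometric series that does not depend on \<open>t\<close>.\<close>

lemma geometric_kernel_sums:
  fixes F :: "real \<Rightarrow> complex"
  assumes sp: "space \<mu> = {0..<1}"
    and int: "\<And>n. integrable \<mu> (\<lambda>t. of_real (t ^ n) * F t)" and "norm z < 1"
  shows "integrable \<mu> (\<lambda>t. F t / (1 - of_real t * z))"
    and "(\<lambda>n. (\<integral>t. of_real (t ^ n) * F t \<partial>\<mu>) * z ^ n) sums (\<integral>t. F t / (1 - of_real t * z) \<partial>\<mu>)"
proof -
  define g where "g n t = of_real (t ^ n) * F t * z ^ n" for n t
  have intg: "integrable \<mu> (g n)" for n
    unfolding g_def by (intro integrable_mult_left int)
  have int0: "integrable \<mu> F" using int[of 0] by simp
  have tz: "norm (of_real t * z) < 1" if "t \<in> {0..<1}" for t :: real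
  proof -
    have "t * norm z \<le> 1 * norm z" using that by (intro mult_right_mono) auto
    with that \<open>norm z < 1\<close> show ?thesis by (simp add: norm_mult)
  qed
  have g_eq: "g n t = F t * (of_real t * z) ^ n" for n t
    by (simp add: g_def power_mult_distrib mult_ac)
  have AE: "AE t in \<mu>. summable (\<lambda>n. norm (g n t))"
    using tz by (intro AE_I2)
      (auto simp: sp g_eq norm_mult norm_power intro!: summable_mult summable_geometric)
  have le: "norm (g n t) \<le> norm (F t) * norm z ^ n" if "t \<in> {0..<1}" for n t
  proof -
    have "norm (of_real t * z) ^ n \<le> norm z ^ n"
      using that by (intro power_mono) (auto simp: norm_mult mult_left_le_one_le)
    then show ?thesis by (simp add: g_eq norm_mult norm_power mult_left_mono)
  qed
  have sm: "summable (\<lambda>n. \<integral>t. norm (g n t) \<partial>\<mu>)"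
  proof (rule summable_comparison_test')
    show "summable (\<lambda>n. (\<integral>t. norm (F t) \<partial>\<mu>) * norm z ^ n)"
      using \<open>norm z < 1\<close> by (intro summable_mult summable_geometric) auto
    fix n :: nat
    have "(\<integral>t. norm (g n t) \<partial>\<mu>) \<le> (\<integral>t. norm (F t) * norm z ^ n \<partial>\<mu>)"
      using le by (intro integral_mono integrable_norm intg integrable_mult_left int0) (auto simp: sp)
    then show "norm (\<integral>t. norm (g n t) \<partial>\<mu>) \<le> (\<integral>t. norm (F t) \<partial>\<mu>) * norm z ^ n"
      by (simp add: integral_nonneg)
  qed
  have eq: "(\<Sum>n. g n t) = F t / (1 - of_real t * z)" if "t \<in> {0..<1}" for t
    using tz[OF that] unfolding g_eq
    by (simp add: suminf_mult summable_geometric suminf_geometric)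
  have "integrable \<mu> (\<lambda>t. \<Sum>n. g n t)" by (rule integrable_suminf[OF intg AE sm])
  then show "integrable \<mu> (\<lambda>t. F t / (1 - of_real t * z))" using eq sp
    by (subst Bochner_Integration.integrable_cong[OF refl, of _ _ "\<lambda>t. \<Sum>n. g n t"]) auto
  have "(\<lambda>n. \<integral>t. g n t \<partial>\<mu>) sums (\<integral>t. (\<Sum>n. g n t) \<partial>\<mu>)"
    by (rule sums_integral[OF intg AE sm])
  moreover have "(\<integral>t. g n t \<partial>\<mu>) = (\<integral>t. of_real (t ^ n) * F t \<partial>\<mu>) * z ^ n" for n
    unfolding g_def by simp
  moreover have "(\<integral>t. (\<Sum>n. g n t) \<partial>\<mu>) = (\<integral>t. F t / (1 - of_real t * z) \<partial>\<mu>)"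
    using eq sp by (intro Bochner_Integration.integral_cong) auto
  ultimately show "(\<lambda>n. (\<integral>t. of_real (t ^ n) * F t \<partial>\<mu>) * z ^ n) sums
      (\<integral>t. F t / (1 - of_real t * z) \<partial>\<mu>)" by simp
qed

section \<open>The Hankel operator on the Bloch space\<close>

theorem theorem2p3:
  fixes \<mu> :: "real measure"
  assumes "borel_measure_01 \<mu>"
    and "(\<integral>\<^sup>+ t. ennreal (ln (2 / (1 - t))) \<partial>\<mu>) < \<infinity>"
    and "carleson (density \<mu> (\<lambda>t. ennreal (ln (2 / (1 - t)))))"
  shows "hankel_well_defined_on \<mu> bloch \<and>
    (\<forall>f\<in>bloch. \<forall>z\<in>ball 0 1. integrable \<mu> (I_integrand f z) \<and> hankel \<mu> f z = I_op \<mu> f z)"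
proof -
  note sp = borel_measure_01_space[OF assms(1)]
  have w: "integrable \<mu> (\<lambda>t. 1 / sqrt (1 - t))"
    by (rule carleson_integrable_inverse_sqrt[OF carleson_of_log_carleson[OF assms(1,3)]])
  have meas: "(\<lambda>t. t ^ k) \<in> borel_measurable \<mu>" for k
    by (intro borel_measure_01_measurable[OF assms(1)] continuous_intros)
  have mom: "integrable \<mu> (\<lambda>t. t ^ k)" for k
  proof (rule Bochner_Integration.integrable_bound[OF w meas], intro AE_I2)
    fix t assume "t \<in> space \<mu>"
    then have t: "0 \<le> t" "t < 1" by (auto simp: sp)
    have "t ^ k \<le> 1" using t by (intro power_le_one) auto
    also have "1 \<le> 1 / sqrt (1 - t)" using t by (simp add: pos_le_divide_eq)
    finally show "norm (t ^ k) \<le> norm (1 / sqrt (1 - t))" using t by simp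
  qed
  have main: "hankel_well_defined \<mu> f \<and>
      (\<forall>z\<in>ball 0 1. integrable \<mu> (I_integrand f z) \<and> hankel \<mu> f z = I_op \<mu> f z)"
    if f: "f \<in> bloch" for f
  proof -
    define a where "a k = fps_nth (fps_expansion f 0) k" for k
    define F where "F t = (\<Sum>k. a k * of_real t ^ k)" for t :: real
    obtain K where K: "\<And>N t. 0 \<le> t \<Longrightarrow> t < 1 \<Longrightarrow> (\<Sum>k<N. norm (a k) * t ^ k) \<le> K / sqrt (1 - t)"
      using bloch_majorant[OF f] unfolding a_def by blast
    have Kw: "integrable \<mu> (\<lambda>t. K / sqrt (1 - t))"
      using integrable_mult_right[OF w, of K] by simp
    note pairing = moment_pairing[OF sp Kw mom, of a, folded F_def]
    have int: "integrable \<mu> (\<lambda>t. of_real (t ^ n) * F t)" for n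
      by (rule pairing) (use K in auto)
    have coeff: "hankel_term \<mu> f n sums (\<integral>t. of_real (t ^ n) * F t \<partial>\<mu>)" for n
      unfolding hankel_term_def a_def[symmetric] by (rule pairing) (use K in auto)
    have hc: "hankel_coeff \<mu> f n = (\<integral>t. of_real (t ^ n) * F t \<partial>\<mu>)" for n
      unfolding hankel_coeff_def by (rule sums_unique[OF coeff, symmetric])
    have F: "F t = f (of_real t)" if "t \<in> space \<mu>" for t
      using bloch_expansion_sums[OF f, of "of_real t"] that unfolding F_def a_def sp
      by (simp add: sums_iff)
    have ker: "integrable \<mu> (I_integrand f z)" "(\<lambda>n. hankel_coeff \<mu> f n * z ^ n) sums I_op \<mu> f z"
      if "norm z < 1" for z
    proof -
      have eq: "I_integrand f z t = F t / (1 - of_real t * z)" if "t \<in> space \<mu>" for t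
        using F[OF that] by (simp add: I_integrand_def)
      show "integrable \<mu> (I_integrand f z)"
        using geometric_kernel_sums(1)[OF sp int that] eq
        by (subst Bochner_Integration.integrable_cong[OF refl]) auto
      have "I_op \<mu> f z = (\<integral>t. F t / (1 - of_real t * z) \<partial>\<mu>)"
        unfolding I_op_def using eq by (intro Bochner_Integration.integral_cong) auto
      then show "(\<lambda>n. hankel_coeff \<mu> f n * z ^ n) sums I_op \<mu> f z"
        using geometric_kernel_sums(2)[OF sp int that] by (simp add: hc)
    qed
    have val: "hankel \<mu> f z = I_op \<mu> f z" if "norm z < 1" for z
      unfolding hankel_def by (rule sums_unique[OF ker(2)[OF that], symmetric])
    have "hankel \<mu> f holomorphic_on ball 0 1"
    proof (rule power_series_holomorphic)
      fix z :: complex assume "z \<in> ball 0 1"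
      then show "(\<lambda>n. hankel_coeff \<mu> f n * (z - 0) ^ n) sums hankel \<mu> f z"
        using ker(2)[of z] val[of z] by simp
    qed
    then have "hankel \<mu> f analytic_on ball 0 1" by (simp add: analytic_on_open)
    then show ?thesis unfolding hankel_well_defined_def
      using mom coeff ker val by (auto simp: sums_iff)
  qed
  then show ?thesis by (auto simp: hankel_well_defined_on_def)
qed

end
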